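(* Let $\mathbb{F}$ be a field and let $A$ and $B$ be nilpotent Leibniz algebras over $\mathbb{F}$. Let $\Phi: B\to \mathrm{Der}(A)/\mathrm{ad}^l(A)$ and $\Phi': B\to \mathscr{L}(A)/\mathrm{ad}^r(A)$ be linear maps, and let $(\varphi,\varphi')$ and $(\psi,\psi')$ be lifts of $(\Phi,\Phi')$ corresponding to extensions $0\to A\to L_{(\varphi,\varphi')}\to B\to 0$ and $0\to A\to L_{(\psi,\psi')}\to B\to 0$ of Leibniz algebras, respectively. Then $L_{(\varphi,\varphi')}$ is nilpotent if and only if $L_{(\psi,\psi')}$ is nilpotent.
   Context: A Leibniz algebra over $\mathbb{F}$ is an $\mathbb{F}$-vector space $L$ with a bilinear multiplication satisfying $x(yz)=(xy)z+y(xz)$ for all $x,y,z\in L$. For subspaces $U,V$ of $L$, $UV$ denotes the span of all products $uv$ with $u\in U$, $v\in V$. The lower central series is $L^0=L$, $L^{k+1}=LL^k$ for $k\ge 0$; $L$ is nilpotent if $L^u=0$ for some $u\ge 0$. $\mathscr{L}(A)$ is the space of linear maps $A\to A$ and $\mathrm{Der}(A)\subseteq\mathscr{L}(A)$ the space of derivations. For $m\in A$ let $\mathrm{ad}^l_m(n)=mn$ and $\mathrm{ad}^r_m(n)=nm$; $\mathrm{ad}^l(A)=\{\mathrm{ad}^l_m : m\in A\}\subseteq \mathrm{Der}(A)$ and $\mathrm{ad}^r(A)=\{\mathrm{ad}^r_m: m\in A\}\subseteq\mathscr{L}(A)$. Let $q:\mathrm{Der}(A)\to\mathrm{Der}(A)/\mathrm{ad}^l(A)$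 and $q':\mathscr{L}(A)\to\mathscr{L}(A)/\mathrm{ad}^r(A)$ be the natural projections (of vector spaces). A lift of $(\Phi,\Phi')$ is a pair of linear maps $\varphi:B\to\mathrm{Der}(A)$, $\varphi':B\to\mathscr{L}(A)$ with $q\varphi=\Phi$ and $q'\varphi'=\Phi'$. An extension of $A$ by $B$ is a short exact sequence $0\to A\xrightarrow{\sigma}L\xrightarrow{\pi}B\to 0$ of Leibniz algebras and homomorphisms. A section is a linear map $T:B\to L$ with $\pi T=\mathrm{id}_B$. A pair $(\varphi,\varphi')$ corresponds to the extension if there is a section $T$ such that $\varphi(i)m=\sigma^{-1}(T(i)\sigma(m))$ and $\varphi'(i)m=\sigma^{-1}(\sigma(m)T(i))$ for all $i\in B$, $m\in A$. *)

theory Defs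
  imports Complex_Main "HOL-Library.Function_Algebras" "HOL-Library.Set_Algebras"
begin

locale leibniz_algebra = vector_space scale
  for scale :: "'f::field \<Rightarrow> 'a::ab_group_add \<Rightarrow> 'a" +
  fixes mult :: "'a \<Rightarrow> 'a \<Rightarrow> 'a"
  assumes linear_mult_left: "Vector_Spaces.linear scale scale (\<lambda>x. mult x y)"
    and linear_mult_right: "Vector_Spaces.linear scale scale (\<lambda>y. mult x y)"
    and leibniz: "mult x (mult y z) = mult (mult x y) z + mult y (mult x z)"
begin

definition prod_space :: "'a set \<Rightarrow> 'a set \<Rightarrow> 'a set" where
  "prod_space U V = span {mult u v | u v. u \<in> U \<and> v \<in> V}"

primrec lower_central :: "nat \<Rightarrow> 'a set" where
  "lower_central 0 = UNIV"
| "lower_central (Suc k) = prod_space UNIV (lower_central k)"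

definition nilpotent :: bool where
  "nilpotent \<longleftrightarrow> (\<exists>u. lower_central u = {0})"

definition End :: "('a \<Rightarrow> 'a) set" where
  "End = {f. Vector_Spaces.linear scale scale f}"

definition Der :: "('a \<Rightarrow> 'a) set" where
  "Der = {d \<in> End. \<forall>m n. d (mult m n) = mult (d m) n + mult m (d n)}"

definition ad_l :: "('a \<Rightarrow> 'a) set" where
  "ad_l = range (\<lambda>m n. mult m n)"

definition ad_r :: "('a \<Rightarrow> 'a) set" where
  "ad_r = range (\<lambda>m n. mult n m)"

end

definition leibniz_hom ::
  "('f::field \<Rightarrow> 'a::ab_group_add \<Rightarrow> 'a) \<Rightarrow> ('a \<Rightarrow> 'a \<Rightarrow> 'a) \<Rightarrow>
   ('f \<Rightarrow> 'b::ab_group_add \<Rightarrow> 'b) \<Rightarrow> ('b \<Rightarrow> 'b \<Rightarrow> 'b) \<Rightarrow> ('a \<Rightarrow> 'b) \<Rightarrow> bool" where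
  "leibniz_hom s m s' m' f \<longleftrightarrow>
     Vector_Spaces.linear s s' f \<and> (\<forall>x y. f (m x y) = m' (f x) (f y))"

definition fun_scale :: "('f \<Rightarrow> 'a \<Rightarrow> 'a) \<Rightarrow> 'f \<Rightarrow> ('c \<Rightarrow> 'a) \<Rightarrow> 'c \<Rightarrow> 'a" where
  "fun_scale s c f = (\<lambda>x. s c (f x))"

text \<open>The quotient V/U of a subspace V by a subspace U of V is represented by
  the set of cosets \<open>v +o U\<close>, with addition the elementwise sum of sets.\<close>

definition quotient_space :: "'v::ab_group_add set \<Rightarrow> 'v set \<Rightarrow> 'v set set" where
  "quotient_space V U = (\<lambda>v. v +o U) ` V"

text \<open>Adding U again only matters for \<open>c = 0\<close>, where the image alone would be
  \<open>{0}\<close> instead of the zero coset U.\<close>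

definition quotient_scale ::
  "('f \<Rightarrow> 'v::ab_group_add \<Rightarrow> 'v) \<Rightarrow> 'v set \<Rightarrow> 'f \<Rightarrow> 'v set \<Rightarrow> 'v set" where
  "quotient_scale s U c X = s c ` X + U"

definition linear_to_quotient ::
  "('f::field \<Rightarrow> 'b::ab_group_add \<Rightarrow> 'b) \<Rightarrow> ('f \<Rightarrow> 'v::ab_group_add \<Rightarrow> 'v) \<Rightarrow>
   'v set \<Rightarrow> 'v set \<Rightarrow> ('b \<Rightarrow> 'v set) \<Rightarrow> bool" where
  "linear_to_quotient sB sV V U \<Phi> \<longleftrightarrow>
     (\<forall>i. \<Phi> i \<in> quotient_space V U) \<and>
     (\<forall>i j. \<Phi> (i + j) = \<Phi> i + \<Phi> j) \<and>
     (\<forall>c i. \<Phi> (sB c i) = quotient_scale sV U c (\<Phi> i))"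

definition is_lift ::
  "('f::field \<Rightarrow> 'a::ab_group_add \<Rightarrow> 'a) \<Rightarrow> ('a \<Rightarrow> 'a \<Rightarrow> 'a) \<Rightarrow>
   ('f \<Rightarrow> 'b::ab_group_add \<Rightarrow> 'b) \<Rightarrow>
   ('b \<Rightarrow> ('a \<Rightarrow> 'a) set) \<Rightarrow> ('b \<Rightarrow> ('a \<Rightarrow> 'a) set) \<Rightarrow>
   ('b \<Rightarrow> 'a \<Rightarrow> 'a) \<Rightarrow> ('b \<Rightarrow> 'a \<Rightarrow> 'a) \<Rightarrow> bool" where
  "is_lift sA mA sB \<Phi> \<Phi>' \<phi> \<phi>' \<longleftrightarrow>
     Vector_Spaces.linear sB (fun_scale sA) \<phi> \<and> range \<phi> \<subseteq> leibniz_algebra.Der sA mA \<and>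
     Vector_Spaces.linear sB (fun_scale sA) \<phi>' \<and> range \<phi>' \<subseteq> leibniz_algebra.End sA \<and>
     (\<forall>i. \<phi> i +o leibniz_algebra.ad_l mA = \<Phi> i) \<and>
     (\<forall>i. \<phi>' i +o leibniz_algebra.ad_r mA = \<Phi>' i)"

locale leibniz_extension =
  A: leibniz_algebra sA mA + L: leibniz_algebra sL mL + B: leibniz_algebra sB mB
  for sA :: "'f::field \<Rightarrow> 'a::ab_group_add \<Rightarrow> 'a" and mA
    and sL :: "'f \<Rightarrow> 'l::ab_group_add \<Rightarrow> 'l" and mL
    and sB :: "'f \<Rightarrow> 'b::ab_group_add \<Rightarrow> 'b" and mB +
  fixes \<sigma> :: "'a \<Rightarrow> 'l" and \<pi> :: "'l \<Rightarrow> 'b"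
  assumes hom_\<sigma>: "leibniz_hom sA mA sL mL \<sigma>"
    and hom_\<pi>: "leibniz_hom sL mL sB mB \<pi>"
    and inj_\<sigma>: "inj \<sigma>"
    and exact: "range \<sigma> = {x. \<pi> x = 0}"
    and surj_\<pi>: "surj \<pi>"
begin

definition is_section :: "('b \<Rightarrow> 'l) \<Rightarrow> bool" where
  "is_section T \<longleftrightarrow> Vector_Spaces.linear sB sL T \<and> \<pi> \<circ> T = id"

definition corresponds :: "('b \<Rightarrow> 'a \<Rightarrow> 'a) \<Rightarrow> ('b \<Rightarrow> 'a \<Rightarrow> 'a) \<Rightarrow> bool" where
  "corresponds \<phi> \<phi>' \<longleftrightarrow>
     (\<exists>T. is_section T \<and>
        (\<forall>i m. \<phi> i m = inv \<sigma> (mL (T i) (\<sigma> m)) \<and> \<phi>' i m = inv \<sigma> (mL (\<sigma> m) (T i))))"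

end

end

theory Submission imports Defs begin

text \<open>Every element of an extension \<open>L\<close> is \<open>T i + \<sigma> b\<close>, so left multiplication by \<open>L\<close> acts on the
  ideal \<open>A\<close> through the operators \<open>\<phi> i + ad_l b\<close>, that is, through the union of the cosets
  \<open>\<Phi> i\<close>. As \<open>B\<close> is nilpotent, some term of the lower central series of \<open>L\<close> lies in \<open>A\<close>, so
  \<open>L\<close> is nilpotent iff long compositions of these operators vanish on \<open>A\<close>. This condition
  depends on \<open>\<Phi>\<close> only.\<close>

context leibniz_algebra
begin

text \<open>The lower central series with left multiplications replaced by an arbitrary set
  \<open>S\<close> of operators; \<open>S = ad_l\<close> gives back \<open>lower_central\<close>.
  Taking spans at each step matches \<open>prod_space\<close> term by term.\<close>

primrec operator_series :: "('a \<Rightarrow> 'a) set \<Rightarrow> nat \<Rightarrow> 'a set" where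
  "operator_series S 0 = UNIV"
| "operator_series S (Suc k) = span {d a | d a. d \<in> S \<and> a \<in> operator_series S k}"

lemma mult_zero_right: "mult x 0 = 0"
proof -
  interpret Vector_Spaces.linear scale scale "\<lambda>y. mult x y" by (rule linear_mult_right)
  show ?thesis by (rule zero)
qed

lemma mult_add_left: "mult (x + y) z = mult x z + mult y z"
proof -
  interpret Vector_Spaces.linear scale scale "\<lambda>x. mult x z" by (rule linear_mult_left)
  show ?thesis by (rule add)
qed

lemma prod_space_mono: "V \<subseteq> W \<Longrightarrow> prod_space U V \<subseteq> prod_space U W"
  unfolding prod_space_def by (rule span_mono) blast

lemma zero_in_lower_central: "0 \<in> lower_central k"
  by (cases k) (simp_all add: prod_space_def span_zero)

lemma zero_in_operator_series: "0 \<in> operator_series S k"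
  by (cases k) (simp_all add: span_zero)

end

lemma leibniz_hom_span_image:
  "leibniz_hom s m s' m' f \<Longrightarrow> f ` module.span s X = module.span s' (f ` X)"
  unfolding leibniz_hom_def Vector_Spaces.linear_iff_module_hom
  by (metis module_hom.span_image)

text \<open>Homomorphisms carry products to products and spans to spans. Applied to \<pi>, this
  pushes a late term of the series of \<open>L\<close> into the kernel.\<close>

lemma leibniz_hom_lower_central:
  assumes "leibniz_algebra s m" "leibniz_algebra s' m'" and hom: "leibniz_hom s m s' m' f"
  shows "f ` leibniz_algebra.lower_central s m k \<subseteq> leibniz_algebra.lower_central s' m' k"
proof -
  interpret X: leibniz_algebra s m by fact
  interpret Y: leibniz_algebra s' m' by fact
  show ?thesis
  proof (induction k)
    case (Suc k)
    have "f ` X.lower_central (Suc k)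
        = Y.span (f ` {m u v | u v. u \<in> UNIV \<and> v \<in> X.lower_central k})"
      by (simp add: X.prod_space_def leibniz_hom_span_image[OF hom])
    also have "\<dots> \<subseteq> Y.span {m' u v | u v. u \<in> UNIV \<and> v \<in> Y.lower_central k}"
    proof (rule Y.span_mono)
      show "f ` {m u v | u v. u \<in> UNIV \<and> v \<in> X.lower_central k}
          \<subseteq> {m' u v | u v. u \<in> UNIV \<and> v \<in> Y.lower_central k}"
        using Suc hom unfolding leibniz_hom_def by blast
    qed
    finally show ?case by (simp add: Y.prod_space_def)
  qed simp
qed

context leibniz_extension
begin

lemma \<pi>_\<sigma>: "\<pi> (\<sigma> a) = 0"
  using exact by blast

lemma \<sigma>_add: "\<sigma> (a + b) = \<sigma> a + \<sigma> b"
proof -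
  interpret Vector_Spaces.linear sA sL \<sigma> using hom_\<sigma> by (simp add: leibniz_hom_def)
  show ?thesis by (rule add)
qed

lemma \<sigma>_zero: "\<sigma> 0 = 0"
  using \<sigma>_add[of 0 0] by simp

lemma \<pi>_diff: "\<pi> (x - y) = \<pi> x - \<pi> y"
proof -
  interpret Vector_Spaces.linear sL sB \<pi> using hom_\<pi> by (simp add: leibniz_hom_def)
  show ?thesis by (rule diff)
qed

text \<open>The range of \<sigma> is the kernel of \<pi>, hence absorbs left multiplication: \<pi>
  sends the product to a multiple of 0.\<close>

lemma mult_\<sigma>_in_range: "mL x (\<sigma> a) \<in> range \<sigma>"
  using hom_\<pi> by (simp add: exact leibniz_hom_def \<pi>_\<sigma> B.mult_zero_right)

lemma section_decomposition:
  assumes "is_section T"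
  obtains b where "x = T (\<pi> x) + \<sigma> b"
proof -
  have "\<pi> (T (\<pi> x)) = \<pi> x"
    using assms unfolding is_section_def by (metis comp_apply id_apply)
  then have "x - T (\<pi> x) \<in> range \<sigma>"
    by (simp add: exact \<pi>_diff)
  then obtain b where "x - T (\<pi> x) = \<sigma> b" by blast
  then show thesis by (intro that[of b]) (simp add: algebra_simps)
qed

text \<open>Writing \<open>x = T i + \<sigma> b\<close>, left multiplication by \<open>x\<close>
  acts on the copy of \<open>A\<close> as \<open>\<phi> i + mA b\<close>, and every pair
  \<open>i\<close>, \<open>b\<close> arises from some \<open>x\<close>. So the choice of section is
  absorbed by the cosets of \<open>ad_l\<close>.\<close>

lemma left_mult_\<sigma>_image:
  assumes "corresponds \<phi> \<phi>'"
  shows "{mL x y | x y. x \<in> UNIV \<and> y \<in> \<sigma> ` V}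
    = \<sigma> ` {d a | d a. d \<in> (\<Union>i. \<phi> i +o A.ad_l) \<and> a \<in> V}" (is "?P = \<sigma> ` ?Q")
proof -
  obtain T where T: "is_section T" and \<phi>: "\<And>i a. \<phi> i a = inv \<sigma> (mL (T i) (\<sigma> a))"
    using assms unfolding corresponds_def by blast
  have act: "mL (T i + \<sigma> b) (\<sigma> a) = \<sigma> ((\<phi> i + mA b) a)" for i a b
  proof -
    \<comment> \<open>Here \<open>inv \<sigma>\<close> yields a true preimage because the product
      stays in the range of \<sigma>.\<close>
    have "\<sigma> (\<phi> i a) = mL (T i) (\<sigma> a)"
      unfolding \<phi> by (rule f_inv_into_f[OF mult_\<sigma>_in_range])
    then show ?thesis
      using hom_\<sigma> by (simp add: leibniz_hom_def L.mult_add_left \<sigma>_add)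
  qed
  have S: "d \<in> (\<Union>i. \<phi> i +o A.ad_l) \<longleftrightarrow> (\<exists>i b. d = \<phi> i + mA b)" for d
    by (auto simp: elt_set_plus_def A.ad_l_def)
  show ?thesis
  proof (intro equalityI subsetI)
    fix z assume "z \<in> ?P"
    then obtain x a where z: "z = mL x (\<sigma> a)" and "a \<in> V" by blast
    moreover obtain b where "x = T (\<pi> x) + \<sigma> b" using section_decomposition[OF T] .
    ultimately have "z = \<sigma> ((\<phi> (\<pi> x) + mA b) a)" by (metis act)
    with \<open>a \<in> V\<close> show "z \<in> \<sigma> ` ?Q" unfolding S by blast
  next
    fix z assume "z \<in> \<sigma> ` ?Q"
    then obtain i b a where "z = \<sigma> ((\<phi> i + mA b) a)" "a \<in> V" unfolding S by blast
    then show "z \<in> ?P" unfolding act[symmetric] by blast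
  qed
qed

text \<open>Spanning both sides of the previous identity, since \<sigma> commutes with spans. Both
  inclusions between the two series then follow by induction from monotonicity of
  \<open>prod_space\<close>.\<close>

lemma \<sigma>_operator_series_Suc:
  assumes "corresponds \<phi> \<phi>'"
  shows "\<sigma> ` A.operator_series (\<Union>i. \<phi> i +o A.ad_l) (Suc k)
    = L.prod_space UNIV (\<sigma> ` A.operator_series (\<Union>i. \<phi> i +o A.ad_l) k)"
  by (simp only: A.operator_series.simps leibniz_hom_span_image[OF hom_\<sigma>]
      L.prod_space_def left_mult_\<sigma>_image[OF assms])

theorem nilpotent_iff_operator_series:
  assumes nilB: "B.nilpotent" and corr: "corresponds \<phi> \<phi>'"
  shows "L.nilpotent \<longleftrightarrow> (\<exists>k. A.operator_series (\<Union>i. \<phi> i +o A.ad_l) k = {0})"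
proof -
  let ?C = "A.operator_series (\<Union>i. \<phi> i +o A.ad_l)"
  have lower: "\<sigma> ` ?C k \<subseteq> L.lower_central k" for k
    by (induction k) (simp_all only: \<sigma>_operator_series_Suc[OF corr] L.lower_central.simps
        L.prod_space_mono subset_UNIV)
  obtain c where "B.lower_central c = {0}"
    using nilB unfolding B.nilpotent_def by blast
  \<comment> \<open>The image under \<pi> lies in \<open>B.lower_central c\<close>, which is zero,
    so exactness applies.\<close>
  then have "L.lower_central c \<subseteq> range \<sigma>"
    using leibniz_hom_lower_central[OF L.leibniz_algebra_axioms B.leibniz_algebra_axioms hom_\<pi>, of c]
    unfolding exact by blast
  \<comment> \<open>The shift by \<open>c\<close> pays for the base case: \<open>?C 0\<close> is all
    of \<open>A\<close>, and \<open>L\<close> needs \<open>c\<close> steps to enter its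
    image.\<close>
  then have upper: "L.lower_central (k + c) \<subseteq> \<sigma> ` ?C k" for k
    by (induction k) (simp_all only: \<sigma>_operator_series_Suc[OF corr] L.lower_central.simps
        L.prod_space_mono add_0 add_Suc A.operator_series.simps(1))
  show ?thesis
  proof
    assume "L.nilpotent"
    then obtain k where "\<sigma> ` ?C k \<subseteq> {0}"
      unfolding L.nilpotent_def using lower by metis
    then have "?C k \<subseteq> {0}"
      using inj_\<sigma> \<sigma>_zero by (auto simp: inj_def)
    then show "\<exists>k. ?C k = {0}"
      using A.zero_in_operator_series by blast
  next
    assume "\<exists>k. ?C k = {0}"
    then obtain k where "?C k = {0}" by blast
    then have "L.lower_central (k + c) \<subseteq> {0}"
      using upper[of k] by (simp add: \<sigma>_zero)
    then show "L.nilpotent"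
      unfolding L.nilpotent_def using L.zero_in_lower_central by blast
  qed
qed

end

theorem theorem3p7:
  fixes sA :: "'f::field \<Rightarrow> 'a::ab_group_add \<Rightarrow> 'a" and mA :: "'a \<Rightarrow> 'a \<Rightarrow> 'a"
    and sB :: "'f \<Rightarrow> 'b::ab_group_add \<Rightarrow> 'b" and mB :: "'b \<Rightarrow> 'b \<Rightarrow> 'b"
    and sL\<^sub>\<phi> :: "'f \<Rightarrow> 'l::ab_group_add \<Rightarrow> 'l" and mL\<^sub>\<phi> :: "'l \<Rightarrow> 'l \<Rightarrow> 'l"
    and sL\<^sub>\<psi> :: "'f \<Rightarrow> 'k::ab_group_add \<Rightarrow> 'k" and mL\<^sub>\<psi> :: "'k \<Rightarrow> 'k \<Rightarrow> 'k"
    and \<Phi> \<Phi>' :: "'b \<Rightarrow> ('a \<Rightarrow> 'a) set"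
    and \<phi> \<phi>' \<psi> \<psi>' :: "'b \<Rightarrow> 'a \<Rightarrow> 'a"
    and \<sigma>\<^sub>\<phi> :: "'a \<Rightarrow> 'l" and \<pi>\<^sub>\<phi> :: "'l \<Rightarrow> 'b"
    and \<sigma>\<^sub>\<psi> :: "'a \<Rightarrow> 'k" and \<pi>\<^sub>\<psi> :: "'k \<Rightarrow> 'b"
  assumes "leibniz_algebra sA mA" and "leibniz_algebra.nilpotent sA mA"
    and "leibniz_algebra sB mB" and "leibniz_algebra.nilpotent sB mB"
    and "linear_to_quotient sB (fun_scale sA)
           (leibniz_algebra.Der sA mA) (leibniz_algebra.ad_l mA) \<Phi>"
    and "linear_to_quotient sB (fun_scale sA)
           (leibniz_algebra.End sA) (leibniz_algebra.ad_r mA) \<Phi>'"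
    and "is_lift sA mA sB \<Phi> \<Phi>' \<phi> \<phi>'"
    and "is_lift sA mA sB \<Phi> \<Phi>' \<psi> \<psi>'"
    and "leibniz_extension sA mA sL\<^sub>\<phi> mL\<^sub>\<phi> sB mB \<sigma>\<^sub>\<phi> \<pi>\<^sub>\<phi>"
    and "leibniz_extension.corresponds sL\<^sub>\<phi> mL\<^sub>\<phi> sB \<sigma>\<^sub>\<phi> \<pi>\<^sub>\<phi> \<phi> \<phi>'"
    and "leibniz_extension sA mA sL\<^sub>\<psi> mL\<^sub>\<psi> sB mB \<sigma>\<^sub>\<psi> \<pi>\<^sub>\<psi>"
    and "leibniz_extension.corresponds sL\<^sub>\<psi> mL\<^sub>\<psi> sB \<sigma>\<^sub>\<psi> \<pi>\<^sub>\<psi> \<psi> \<psi>'"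
  shows "leibniz_algebra.nilpotent sL\<^sub>\<phi> mL\<^sub>\<phi> \<longleftrightarrow> leibniz_algebra.nilpotent sL\<^sub>\<psi> mL\<^sub>\<psi>"
proof -
  \<comment> \<open>For each \<open>i\<close> both cosets equal \<open>\<Phi> i\<close>, by the
    definition of a lift.\<close>
  have same: "(\<Union>i. \<phi> i +o leibniz_algebra.ad_l mA) = (\<Union>i. \<psi> i +o leibniz_algebra.ad_l mA)"
    using assms(7,8) by (simp add: is_lift_def)
  show ?thesis
    unfolding leibniz_extension.nilpotent_iff_operator_series[OF assms(9,4,10)]
      leibniz_extension.nilpotent_iff_operator_series[OF assms(11,4,12)] same ..
qed

end
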